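(* Consider the multiple group random coefficient regression model with one treatment group and one control group ($J=2$). The $D$-optimal weight for the prediction of the individual treatment effects, i.e. the $w\in(0,1)$ minimizing the approximate-design $D$-criterion $\mathrm{D}_{\Psi}(w)$, is $$w^*_{D,\Psi}=\frac{1}{N\,t}+\frac12+\sqrt{\frac{1}{N^2t^2}+\frac14},\qquad\text{where } t=\ln\left(\frac{Ku+1}{K(u+v)+1}\right).$$
   Context: Model ($J=2$). Let $N,K,n\ge1$ be integers with $m:=N-n\ge1$, and let $\sigma^2,u,v>0$ be given reals. Individuals $i=1,\dots,n$ form the treatment group and $i=n+1,\dots,N$ the control group. For $k=1,\dots,K$ one observes $Y_{1ik}=\mu_i+\alpha_{1i}+\varepsilon_{1ik}$ for $i\le n$ and $Y_{2ik}=\mu_i+\varepsilon_{2ik}$ for $i>n$. The random variables $\mu_i$, $\alpha_{1i}$ (defined for all $i=1,\dots,N$) and the errors are all pairwise uncorrelated, with $\mathrm{E}(\mu_i)=\mu$, $\mathrm{E}(\alpha_{1i})=\alpha_1$ (unknown), $\mathrm{var}(\mu_i)=u\sigma^2$, $\mathrm{var}(\alpha_{1i})=v\sigma^2$, and errors of mean zero and variance $\sigma^2$. Criterion. Let $\hat\Psi$ be the best linear unbiased predictor of $\Psi=(\alpha_{11},\dots,\alpha_{1N})^\top$. The $D$-criterion of an exact design is $\ln\det\mathrm{Cov}(\hat\Psi-\Psi)$. For an approximate design (weight $w=n/N$ for the treatment group and $1-w=m/N$ for the control group, $w$ ranging over all reals in $(0,1)$), it is obtained by substituting $n=Nw$,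 $m=N(1-w)$, which gives $$\mathrm{D}_{\Psi}(w)=d+N\,w\,\ln\left(\frac{Ku+1}{K(u+v)+1}\right)-\ln\left(w(1-w)\right),\qquad d=\ln\left((\sigma^2)^N v^{N-1}(K(u+v)+1)\frac1K\right).$$ *)

theory Defs
  imports "HOL-Probability.Probability" "Jordan_Normal_Form.Determinant"
begin

text \<open>
  Individuals are indexed by \<open>0, \<dots>, N - 1\<close>; those with index below \<open>n\<close> are treated and the others
  are controls. Replicates are indexed by \<open>0, \<dots>, K - 1\<close>. All random quantities of the model are
  collected in one family \<open>X\<close>: \<open>X (Mu i)\<close> is $\mu_i$, \<open>X (Alpha i)\<close> is $\alpha_{1i}$ and
  \<open>X (Eps i k)\<close> is the error of the \<open>k\<close>-th observation of individual \<open>i\<close>.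
\<close>

datatype effect = Mu nat | Alpha nat | Eps nat nat

definition effects :: "nat \<Rightarrow> nat \<Rightarrow> effect set" where
  "effects N K = Mu ` {..<N} \<union> Alpha ` {..<N} \<union> (\<lambda>(i, k). Eps i k) ` ({..<N} \<times> {..<K})"

definition covar :: "'w measure \<Rightarrow> ('w \<Rightarrow> real) \<Rightarrow> ('w \<Rightarrow> real) \<Rightarrow> real" where
  "covar M Y Z = (LINT \<omega>|M. (Y \<omega> - (LINT x|M. Y x)) * (Z \<omega> - (LINT x|M. Z x)))"

text \<open>
  The means $\mu$ and $\alpha_1$ are unknown. As usual for a statistical model, there is therefore one
  probability measure \<open>P \<mu> \<alpha>\<close> for every pair of values of the means; the dispersion parameters
  \<open>\<sigma>2\<close> (the error variance $\sigma^2$ itself), \<open>u\<close> and \<open>v\<close> are given.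
\<close>

fun effect_mean :: "real \<Rightarrow> real \<Rightarrow> effect \<Rightarrow> real" where
  "effect_mean \<mu> \<alpha> (Mu i) = \<mu>"
| "effect_mean \<mu> \<alpha> (Alpha i) = \<alpha>"
| "effect_mean \<mu> \<alpha> (Eps i k) = 0"

fun effect_var :: "real \<Rightarrow> real \<Rightarrow> real \<Rightarrow> effect \<Rightarrow> real" where
  "effect_var \<sigma>2 u v (Mu i) = u * \<sigma>2"
| "effect_var \<sigma>2 u v (Alpha i) = v * \<sigma>2"
| "effect_var \<sigma>2 u v (Eps i k) = \<sigma>2"

locale two_group_rcr =
  fixes N n K :: nat and \<sigma>2 u v :: real
    and P :: "real \<Rightarrow> real \<Rightarrow> 'w measure"
    and X :: "effect \<Rightarrow> 'w \<Rightarrow> real"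
  assumes sizes: "1 \<le> n" "n < N" "1 \<le> K"
    and pos: "0 < \<sigma>2" "0 < u" "0 < v"
    and prob: "\<And>\<mu> \<alpha>. prob_space (P \<mu> \<alpha>)"
    and L1: "\<And>\<mu> \<alpha> e. e \<in> effects N K \<Longrightarrow> integrable (P \<mu> \<alpha>) (X e)"
    and L2: "\<And>\<mu> \<alpha> e. e \<in> effects N K \<Longrightarrow> integrable (P \<mu> \<alpha>) (\<lambda>\<omega>. (X e \<omega>)\<^sup>2)"
    and mean: "\<And>\<mu> \<alpha> e. e \<in> effects N K \<Longrightarrow> (LINT \<omega>|P \<mu> \<alpha>. X e \<omega>) = effect_mean \<mu> \<alpha> e"
    and var: "\<And>\<mu> \<alpha> e. e \<in> effects N K \<Longrightarrow> covar (P \<mu> \<alpha>) (X e) (X e) = effect_var \<sigma>2 u v e"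
    and uncorrelated: "\<And>\<mu> \<alpha> e f. e \<in> effects N K \<Longrightarrow> f \<in> effects N K \<Longrightarrow> e \<noteq> f \<Longrightarrow>
      covar (P \<mu> \<alpha>) (X e) (X f) = 0"

definition obs :: "nat \<Rightarrow> (effect \<Rightarrow> 'w \<Rightarrow> real) \<Rightarrow> nat \<Rightarrow> nat \<Rightarrow> 'w \<Rightarrow> real" where
  "obs n X i k \<omega> = X (Mu i) \<omega> + (if i < n then X (Alpha i) \<omega> else 0) + X (Eps i k) \<omega>"

text \<open>
  A linear predictor of $\Psi = (\alpha_{11}, \dots, \alpha_{1N})^\top$ is given by its coefficients:
  \<open>C r i k\<close> is the coefficient of observation \<open>(i, k)\<close> in the predictor of the effect of
  individual \<open>r\<close>. A constant term need not be allowed, since unbiasedness at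
  $\mu = \alpha_1 = 0$ forces it to vanish.
\<close>

definition pred_error ::
  "nat \<Rightarrow> nat \<Rightarrow> nat \<Rightarrow> (effect \<Rightarrow> 'w \<Rightarrow> real) \<Rightarrow> (nat \<Rightarrow> nat \<Rightarrow> nat \<Rightarrow> real) \<Rightarrow> nat \<Rightarrow> 'w \<Rightarrow> real"
where
  "pred_error N n K X C r \<omega> = (\<Sum>i<N. \<Sum>k<K. C r i k * obs n X i k \<omega>) - X (Alpha r) \<omega>"

definition error_cov ::
  "nat \<Rightarrow> nat \<Rightarrow> nat \<Rightarrow> (effect \<Rightarrow> 'w \<Rightarrow> real) \<Rightarrow> 'w measure \<Rightarrow> (nat \<Rightarrow> nat \<Rightarrow> nat \<Rightarrow> real) \<Rightarrow> real mat"
where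
  "error_cov N n K X M C =
    mat N N (\<lambda>(r, s). covar M (pred_error N n K X C r) (pred_error N n K X C s))"

definition unbiased ::
  "nat \<Rightarrow> nat \<Rightarrow> nat \<Rightarrow> (real \<Rightarrow> real \<Rightarrow> 'w measure) \<Rightarrow> (effect \<Rightarrow> 'w \<Rightarrow> real) \<Rightarrow>
    (nat \<Rightarrow> nat \<Rightarrow> nat \<Rightarrow> real) \<Rightarrow> bool"
where
  "unbiased N n K P X C \<longleftrightarrow>
    (\<forall>\<mu> \<alpha>. \<forall>r<N. (LINT \<omega>|P \<mu> \<alpha>. pred_error N n K X C r \<omega>) = 0)"

definition loewner_le :: "nat \<Rightarrow> real mat \<Rightarrow> real mat \<Rightarrow> bool" where
  "loewner_le N A B \<longleftrightarrow>
    (\<forall>x \<in> carrier_vec N. scalar_prod x (A *\<^sub>v x) \<le> scalar_prod x (B *\<^sub>v x))"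

definition is_blup ::
  "nat \<Rightarrow> nat \<Rightarrow> nat \<Rightarrow> (real \<Rightarrow> real \<Rightarrow> 'w measure) \<Rightarrow> (effect \<Rightarrow> 'w \<Rightarrow> real) \<Rightarrow>
    (nat \<Rightarrow> nat \<Rightarrow> nat \<Rightarrow> real) \<Rightarrow> bool"
where
  "is_blup N n K P X C \<longleftrightarrow> unbiased N n K P X C \<and>
    (\<forall>C'. unbiased N n K P X C' \<longrightarrow>
      (\<forall>\<mu> \<alpha>. loewner_le N (error_cov N n K X (P \<mu> \<alpha>) C) (error_cov N n K X (P \<mu> \<alpha>) C')))"

definition D_exact ::
  "nat \<Rightarrow> nat \<Rightarrow> nat \<Rightarrow> (effect \<Rightarrow> 'w \<Rightarrow> real) \<Rightarrow> 'w measure \<Rightarrow> (nat \<Rightarrow> nat \<Rightarrow> nat \<Rightarrow> real) \<Rightarrow> real"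
where
  "D_exact N n K X M C = ln (Determinant.det (error_cov N n K X M C))"

text \<open>
  The criterion for approximate designs: \<open>D_exact\<close> of the best linear unbiased predictor is
  $d + n \ln\frac{Ku+1}{K(u+v)+1} - \ln\frac{nm}{N^2}$ with $m = N - n$, in which one
  substitutes $n = Nw$ and $m = N(1 - w)$ for real $w$.
\<close>

definition D_approx :: "nat \<Rightarrow> nat \<Rightarrow> real \<Rightarrow> real \<Rightarrow> real \<Rightarrow> real \<Rightarrow> real" where
  "D_approx N K \<sigma>2 u v w =
    ln (\<sigma>2 ^ N * v ^ (N - 1) * (real K * (u + v) + 1) * (1 / real K))
    + real N * w * ln ((real K * u + 1) / (real K * (u + v) + 1))
    - ln (w * (1 - w))"

end

theory Submission
  imports Defs
begin

text \<open>
  Two independent facts are combined: the criterion is the logarithm of an explicitly known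
  determinant, and it is a strictly convex function of the weight.

  For the first one, every observation and every prediction error is a linear combination of the
  uncorrelated effects, so that covariances reduce to one diagonal bilinear form. Unbiasedness is a
  condition on the totals of the weights in the two groups (\<open>unbiased_iff_group_totals\<close>), and the
  difference of two unbiased predictors has totals zero. The candidate \<open>blup\<close> estimates the mean
  effect by the difference of the group averages and corrects it, for treated individuals, by their
  shrunk deviation from the group average. Its error has constant covariance with the observations of each
  group (\<open>effect_cov_blup_obs\<close>); it is thus orthogonal to all differences of unbiased predictors, which
  gives optimality in the Loewner order (\<open>is_blup_blup\<close>). By antisymmetry of that order all best
  predictors have the same error covariance. This matrix is constant on the blocks formed by the two
  groups except for its diagonal, so one block elimination gives its determinant
  (\<open>det_two_group_constant\<close>, \<open>det_error_cov_blup\<close>).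

  For the second one, write \<open>s = N t\<close>, which is negative as \<open>v > 0\<close>. Up to a constant the criterion is
  \<open>s w - ln w - ln (1 - w)\<close>. Its derivative vanishes at the stated point, the only root in the unit
  interval of a quadratic equation, and the tangent inequality for the logarithm shows that every
  other weight gives a strictly larger value.
\<close>

section \<open>Determinants of matrices that are constant on two groups\<close>

text \<open>
  The all-ones vector is an eigenvector, with eigenvalue \<open>p + n q\<close>. Completing it to a basis with
  the standard unit vectors other than the first one makes the matrix upper triangular.
\<close>

lemma det_scalar_plus_const:
  fixes p q :: "'a :: comm_ring_1"
  assumes "0 < n"
  shows "Determinant.det (mat n n (\<lambda>(i, j). (if i = j then p else 0) + q)) =
    p ^ (n - 1) * (p + of_nat n * q)"
proof -
  define M where "M = mat n n (\<lambda>(i, j). (if i = j then p else 0) + q)"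
  define S :: "'a mat" where "S = mat n n (\<lambda>(i, j). if i = j \<or> j = 0 then 1 else 0)"
  define R where "R = mat n n (\<lambda>(i, j). if j = 0 then (if i = 0 then p + of_nat n * q else 0)
    else if i = j then p else if i = 0 then q else 0)"
  have carr: "M \<in> carrier_mat n n" "S \<in> carrier_mat n n" "R \<in> carrier_mat n n"
    by (auto simp: M_def S_def R_def)
  \<comment> \<open>the columns of \<open>S\<close> are the new basis, and \<open>R\<close> is the matrix in that basis\<close>
  have "M * S = S * R"
  proof (rule eq_matI)
    fix i j assume "i < dim_row (S * R)" "j < dim_col (S * R)"
    then have ij: "i < n" "j < n" using carr by auto
    have MS: "(M * S) $$ (i, j) = (if j = 0 then p + of_nat n * q else (if i = j then p else 0) + q)"
      using ij by (auto simp: M_def S_def scalar_prod_def sum.distrib if_distrib[where f = "\<lambda>x. _ * x"] cong: if_cong)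
    have "(S * R) $$ (i, j) = (\<Sum>k = 0..<n. (if i = k \<or> k = 0 then 1 else 0) * R $$ (k, j))"
      using ij carr by (auto simp: S_def scalar_prod_def)
    also have "\<dots> = (\<Sum>k = 0..<n. (if k = i then R $$ (k, j) else 0) +
        (if k = 0 then (if i = 0 then 0 else R $$ (k, j)) else 0))"
      by (intro sum.cong) auto
    also have "\<dots> = R $$ (i, j) + (if i = 0 then 0 else R $$ (0, j))"
      using ij by (simp add: sum.distrib)
    also have "\<dots> = (if j = 0 then p + of_nat n * q else (if i = j then p else 0) + q)"
      using ij assms by (auto simp: R_def)
    finally show "(M * S) $$ (i, j) = (S * R) $$ (i, j)" using MS by simp
  qed (use carr in auto)
  moreover have "Determinant.det S = 1"
    by (subst det_lower_triangular[OF _ carr(2)])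
      (auto simp: S_def prod_list_diag_prod)
  ultimately have "Determinant.det M = Determinant.det R"
    using det_mult[OF carr(1,2)] det_mult[OF carr(2,3)] by simp
  also have "\<dots> = (\<Prod>i = 0..<n. R $$ (i, i))"
    using carr by (subst det_upper_triangular[OF _ carr(3)]) (auto simp: R_def prod_list_diag_prod)
  also have "\<dots> = (\<Prod>i\<in>insert 0 {1..<n}. R $$ (i, i))"
    using assms by (intro prod.cong) auto
  also have "\<dots> = R $$ (0, 0) * (\<Prod>i = 1..<n. p)"
    by (subst prod.insert) (auto simp: R_def)
  finally show ?thesis using assms by (simp add: M_def R_def mult.commute)
qed

text \<open>
  The first diagonal block has constant column sums \<open>p + n q\<close>. Adding its rows up with the common
  factor \<open>b / (p + n q)\<close> therefore produces a row with entries \<open>b\<close> over the first group, and subtracting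
  it from every row of the second group clears the off-diagonal block. Both diagonal blocks are then
  a scalar matrix plus a constant one.
\<close>

lemma det_two_group_constant:
  fixes p q b s t :: "'a :: field"
  assumes "0 < n" "0 < m" and nz: "p + of_nat n * q \<noteq> 0"
  shows "Determinant.det (mat (n + m) (n + m) (\<lambda>(i, j).
      (if i = j then (if i < n then p else s) else 0) +
      (if i < n \<and> j < n then q else if i < n \<or> j < n then b else t))) =
    p ^ (n - 1) * s ^ (m - 1) *
      ((p + of_nat n * q) * (s + of_nat m * t) - of_nat n * of_nat m * b\<^sup>2)"
proof -
  define M where "M = mat (n + m) (n + m) (\<lambda>(i, j).
      (if i = j then (if i < n then p else s) else 0) +
      (if i < n \<and> j < n then q else if i < n \<or> j < n then b else t))"
  define x where "x = b / (p + of_nat n * q)"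
  define L where "L = mat (n + m) (n + m) (\<lambda>(i, k).
      (if k = i then 1 else 0) - (if n \<le> i \<and> k < n then x else 0))"
  define T where "T = mat n n (\<lambda>(i, j). (if i = j then p else 0) + q)"
  define W where "W = mat m m (\<lambda>(i, j). (if i = j then s else 0) + (t - x * of_nat n * b))"
  define U where "U = four_block_mat T (mat n m (\<lambda>_. b)) (0\<^sub>m m n) W"
  have carr: "M \<in> carrier_mat (n + m) (n + m)" "L \<in> carrier_mat (n + m) (n + m)"
      "T \<in> carrier_mat n n" "W \<in> carrier_mat m m" "U \<in> carrier_mat (n + m) (n + m)"
    by (auto simp: M_def L_def T_def W_def U_def)
  have colsum: "(\<Sum>k<n. M $$ (k, j)) = (if j < n then p + of_nat n * q else of_nat n * b)"
    if "j < n + m" for j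
  proof -
    have "(\<Sum>k<n. M $$ (k, j)) = (\<Sum>k<n. (if k = j then p else 0) + (if j < n then q else b))"
      using that by (intro sum.cong) (auto simp: M_def)
    then show ?thesis by (simp add: sum.distrib)
  qed
  have "L * M = U"
  proof (rule eq_matI)
    fix i j assume "i < dim_row U" "j < dim_col U"
    then have ij: "i < n + m" "j < n + m" using carr by auto
    have "(L * M) $$ (i, j) = (\<Sum>k = 0..<n + m.
        ((if k = i then 1 else 0) - (if n \<le> i \<and> k < n then x else 0)) * M $$ (k, j))"
      using ij carr by (auto simp: L_def scalar_prod_def)
    also have "\<dots> = (\<Sum>k = 0..<n + m. (if k = i then M $$ (k, j) else 0)) -
        (\<Sum>k = 0..<n + m. if k < n then (if n \<le> i then x * M $$ (k, j) else 0) else 0)"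
      unfolding sum_subtractf[symmetric] by (intro sum.cong) (auto simp: algebra_simps)
    also have "(\<Sum>k = 0..<n + m. if k < n then (if n \<le> i then x * M $$ (k, j) else 0) else 0) =
        (\<Sum>k<n. if n \<le> i then x * M $$ (k, j) else 0)"
      by (intro sum.mono_neutral_cong_right) auto
    also have "\<dots> = (if n \<le> i then x * (\<Sum>k<n. M $$ (k, j)) else 0)"
      by (simp add: sum_distrib_left)
    finally have "(L * M) $$ (i, j) = M $$ (i, j) -
        (if n \<le> i then x * (if j < n then p + of_nat n * q else of_nat n * b) else 0)"
      using ij by (simp add: colsum)
    also have "\<dots> = U $$ (i, j)"
      using ij nz unfolding U_def
      by (subst index_mat_four_block) (auto simp: M_def T_def W_def x_def)
    finally show "(L * M) $$ (i, j) = U $$ (i, j)" .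
  qed (use carr in auto)
  moreover have "Determinant.det L = 1"
    by (subst det_lower_triangular[OF _ carr(2)]) (auto simp: L_def prod_list_diag_prod intro!: prod.neutral)
  ultimately have "Determinant.det M = Determinant.det U"
    using det_mult[OF carr(2,1)] by simp
  also have "\<dots> = Determinant.det T * Determinant.det W"
    unfolding U_def by (rule det_four_block_mat_lower_left_zero) (use carr in auto)
  also have "\<dots> = p ^ (n - 1) * (p + of_nat n * q) *
      (s ^ (m - 1) * (s + of_nat m * (t - x * of_nat n * b)))"
    unfolding T_def W_def by (simp only: det_scalar_plus_const[OF assms(1)] det_scalar_plus_const[OF assms(2)])
  also have "\<dots> = p ^ (n - 1) * s ^ (m - 1) *
      ((p + of_nat n * q) * (s + of_nat m * t) - of_nat n * of_nat m * b\<^sup>2)"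
    using nz by (simp add: x_def divide_simps) (simp add: algebra_simps power2_eq_square)
  finally show ?thesis by (simp add: M_def)
qed

section \<open>The Loewner order\<close>

lemma quadratic_form_mat:
  fixes A :: "real mat"
  assumes "A \<in> carrier_mat N N"
  shows "scalar_prod (vec N f) (A *\<^sub>v vec N f) = (\<Sum>i<N. \<Sum>j<N. f i * A $$ (i, j) * f j)"
  using assms
  by (auto simp: scalar_prod_def mult_mat_vec_def sum_distrib_left atLeast0LessThan mult.assoc
      intro!: sum.cong)

text \<open>
  A symmetric matrix is determined by its quadratic form, by polarization: the test vectors are
  the sums of two unit vectors.
\<close>

lemma loewner_le_antisym:
  assumes carr: "A \<in> carrier_mat N N" "B \<in> carrier_mat N N"
    and sym: "\<And>i j. i < N \<Longrightarrow> j < N \<Longrightarrow> A $$ (i, j) = A $$ (j, i)"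
      "\<And>i j. i < N \<Longrightarrow> j < N \<Longrightarrow> B $$ (i, j) = B $$ (j, i)"
    and le: "loewner_le N A B" "loewner_le N B A"
  shows "A = B"
proof -
  have polar: "scalar_prod x (D *\<^sub>v x) = D $$ (i, i) + D $$ (i, j) + D $$ (j, i) + D $$ (j, j)"
    if "D \<in> carrier_mat N N" "i < N" "j < N"
      "x = vec N (\<lambda>k. (if k = i then 1 else 0) + (if k = j then 1 else 0))"
    for D :: "real mat" and i j x
    using that
    by (simp add: quadratic_form_mat distrib_left distrib_right sum.distrib
        if_distrib[where f = "\<lambda>x. _ * x"] if_distrib[where f = "\<lambda>x. x * _"] cong: if_cong)
  have eq: "A $$ (i, i) + A $$ (i, j) + A $$ (j, i) + A $$ (j, j) =
      B $$ (i, i) + B $$ (i, j) + B $$ (j, i) + B $$ (j, j)" if "i < N" "j < N" for i j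
  proof -
    let ?x = "vec N (\<lambda>k. (if k = i then 1 else 0) + (if k = j then 1 else 0)) :: real vec"
    have "scalar_prod ?x (A *\<^sub>v ?x) = scalar_prod ?x (B *\<^sub>v ?x)"
      using le unfolding loewner_le_def by (intro antisym) auto
    then show ?thesis using polar[OF carr(1) that refl] polar[OF carr(2) that refl] by simp
  qed
  show ?thesis
  proof (rule eq_matI)
    fix i j assume "i < dim_row B" "j < dim_col B"
    then have ij: "i < N" "j < N" using carr by auto
    show "A $$ (i, j) = B $$ (i, j)"
      using eq[OF ij] eq[OF ij(1) ij(1)] eq[OF ij(2) ij(2)] sym(1)[OF ij] sym(2)[OF ij] by linarith
  qed (use carr in auto)
qed

section \<open>Linear combinations of uncorrelated effects\<close>

lemma integrable_mult_of_squares: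
  fixes f g :: "'a \<Rightarrow> real"
  assumes [measurable]: "f \<in> borel_measurable M" "g \<in> borel_measurable M"
    and sq: "integrable M (\<lambda>x. (f x)\<^sup>2)" "integrable M (\<lambda>x. (g x)\<^sup>2)"
  shows "integrable M (\<lambda>x. f x * g x)"
proof (rule Bochner_Integration.integrable_bound)
  show "integrable M (\<lambda>x. (f x)\<^sup>2 + (g x)\<^sup>2)" using sq by simp
  have "\<bar>f x * g x\<bar> \<le> (f x)\<^sup>2 + (g x)\<^sup>2" for x
  proof -
    have "2 * (\<bar>f x\<bar> * \<bar>g x\<bar>) \<le> (f x)\<^sup>2 + (g x)\<^sup>2"
      using zero_le_power2[of "\<bar>f x\<bar> - \<bar>g x\<bar>"] by (simp add: power2_diff mult.assoc)
    moreover have "0 \<le> \<bar>f x\<bar> * \<bar>g x\<bar>" by simp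
    ultimately show ?thesis unfolding abs_mult by linarith
  qed
  then show "AE x in M. norm (f x * g x) \<le> norm ((f x)\<^sup>2 + (g x)\<^sup>2)"
    by (simp add: add_nonneg_nonneg)
qed simp

text \<open>
  Substituting the model equation into \<open>\<Sum>i k. G i k * Y i k\<close> turns it into a linear combination of the
  uncorrelated effects; \<open>obs_coeff\<close> gives its coefficients. On such coefficient families, covariances
  become the diagonal bilinear form \<open>effect_cov\<close>.
\<close>

fun obs_coeff :: "nat \<Rightarrow> nat \<Rightarrow> (nat \<Rightarrow> nat \<Rightarrow> real) \<Rightarrow> effect \<Rightarrow> real" where
  "obs_coeff n K G (Mu i) = (\<Sum>k<K. G i k)"
| "obs_coeff n K G (Alpha i) = (if i < n then \<Sum>k<K. G i k else 0)"
| "obs_coeff n K G (Eps i k) = G i k"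

definition err_coeff :: "nat \<Rightarrow> nat \<Rightarrow> (nat \<Rightarrow> nat \<Rightarrow> nat \<Rightarrow> real) \<Rightarrow> nat \<Rightarrow> effect \<Rightarrow> real" where
  "err_coeff n K C r e = obs_coeff n K (C r) e - (if e = Alpha r then 1 else 0)"

definition effect_cov ::
  "nat \<Rightarrow> nat \<Rightarrow> real \<Rightarrow> real \<Rightarrow> real \<Rightarrow> (effect \<Rightarrow> real) \<Rightarrow> (effect \<Rightarrow> real) \<Rightarrow> real" where
  "effect_cov N K \<sigma>2 u v c d = (\<Sum>e\<in>effects N K. effect_var \<sigma>2 u v e * c e * d e)"

lemma finite_effects: "finite (effects N K)"
  by (simp add: effects_def)

lemma sum_effects:
  fixes h :: "effect \<Rightarrow> real"
  shows "(\<Sum>e\<in>effects N K. h e) =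
    (\<Sum>i<N. h (Mu i)) + (\<Sum>i<N. h (Alpha i)) + (\<Sum>i<N. \<Sum>k<K. h (Eps i k))"
proof -
  have "(\<Sum>e\<in>effects N K. h e) = (\<Sum>e\<in>Mu ` {..<N}. h e) + (\<Sum>e\<in>Alpha ` {..<N}. h e) +
      (\<Sum>e\<in>(\<lambda>(i, k). Eps i k) ` ({..<N} \<times> {..<K}). h e)"
    unfolding effects_def by (subst sum.union_disjoint; (subst sum.union_disjoint)?) auto
  then show ?thesis
    by (simp add: sum.reindex inj_on_def sum.cartesian_product split_def)
qed

lemma sum_treated:
  fixes f :: "nat \<Rightarrow> real"
  assumes "n \<le> N"
  shows "(\<Sum>i<N. if i < n then f i else 0) = (\<Sum>i<n. f i)"
  using assms by (intro sum.mono_neutral_cong_right) auto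

lemma obs_combination:
  assumes "n \<le> N"
  shows "(\<Sum>i<N. \<Sum>k<K. G i k * obs n X i k \<omega>) = (\<Sum>e\<in>effects N K. obs_coeff n K G e * X e \<omega>)"
proof -
  have "(\<Sum>k<K. G i k * obs n X i k \<omega>) = (\<Sum>k<K. G i k) * X (Mu i) \<omega> +
      (if i < n then \<Sum>k<K. G i k else 0) * X (Alpha i) \<omega> + (\<Sum>k<K. G i k * X (Eps i k) \<omega>)" for i
    by (simp add: obs_def distrib_left sum.distrib sum_distrib_right)
  then show ?thesis by (simp add: sum_effects sum.distrib)
qed

lemma pred_error_combination:
  assumes "n \<le> N" "r < N"
  shows "pred_error N n K X C r = (\<lambda>\<omega>. \<Sum>e\<in>effects N K. err_coeff n K C r e * X e \<omega>)"
proof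
  fix \<omega>
  have "Alpha r \<in> effects N K" using assms by (auto simp: effects_def)
  then have "(\<Sum>e\<in>effects N K. (if e = Alpha r then 1 else 0) * X e \<omega>) = X (Alpha r) \<omega>"
    by (simp add: finite_effects if_distrib[where f = "\<lambda>x. x * _"] cong: if_cong)
  then show "pred_error N n K X C r \<omega> = (\<Sum>e\<in>effects N K. err_coeff n K C r e * X e \<omega>)"
    using assms by (simp add: pred_error_def err_coeff_def obs_combination left_diff_distrib sum_subtractf)
qed

lemma effect_cov_commute: "effect_cov N K \<sigma>2 u v c d = effect_cov N K \<sigma>2 u v d c"
  unfolding effect_cov_def by (intro sum.cong) auto

text \<open>
  The factor next to \<open>G i k\<close> is, up to \<open>\<sigma>2\<close>, the covariance of the combination \<open>c\<close> with the single
  observation \<open>(i, k)\<close>.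
\<close>

lemma effect_cov_obs:
  assumes "n \<le> N"
  shows "effect_cov N K \<sigma>2 u v c (obs_coeff n K G) =
    \<sigma>2 * (\<Sum>i<N. (\<Sum>k<K. G i k * (u * c (Mu i) + (if i < n then v * c (Alpha i) else 0) + c (Eps i k))))"
proof -
  have "(\<Sum>k<K. G i k * (u * c (Mu i) + (if i < n then v * c (Alpha i) else 0) + c (Eps i k))) =
    u * c (Mu i) * (\<Sum>k<K. G i k) + v * c (Alpha i) * (if i < n then \<Sum>k<K. G i k else 0) +
    (\<Sum>k<K. c (Eps i k) * G i k)" for i
    by (simp add: distrib_left sum.distrib sum_distrib_left mult_ac)
  then show ?thesis
    by (simp add: effect_cov_def sum_effects sum.distrib distrib_left sum_distrib_left mult_ac)
qed

lemma effect_cov_err: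
  assumes "r < N"
  shows "effect_cov N K \<sigma>2 u v c (err_coeff n K C r) =
    effect_cov N K \<sigma>2 u v c (obs_coeff n K (C r)) - v * \<sigma>2 * c (Alpha r)"
proof -
  have "Alpha r \<in> effects N K" using assms by (auto simp: effects_def)
  then have "(\<Sum>e\<in>effects N K. effect_var \<sigma>2 u v e * c e * (if e = Alpha r then 1 else 0)) = v * \<sigma>2 * c (Alpha r)"
    by (simp add: finite_effects if_distrib[where f = "\<lambda>x. _ * x"] cong: if_cong)
  then show ?thesis
    by (simp add: effect_cov_def err_coeff_def right_diff_distrib sum_subtractf)
qed

section \<open>The best linear unbiased predictor\<close>

text \<open>
  The weight of the average observation of individual \<open>i\<close> in the prediction of the effect of \<open>r\<close>. The
  mean effect is estimated by the difference of the two group averages. For a treated \<open>r\<close>, the deviation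
  of the average of \<open>r\<close> from that of its group is added, shrunk by the factor \<open>K v / (K (u + v) + 1)\<close>,
  which is the regression coefficient of the effect on this average.
\<close>

definition blup_weight :: "nat \<Rightarrow> nat \<Rightarrow> nat \<Rightarrow> real \<Rightarrow> real \<Rightarrow> nat \<Rightarrow> nat \<Rightarrow> real" where
  "blup_weight N n K u v r i =
    (if n \<le> i then - 1 / (real N - real n)
     else 1 / real n + (if r < n then
       real K * v / (real K * (u + v) + 1) * ((if i = r then 1 else 0) - 1 / real n) else 0))"

definition blup :: "nat \<Rightarrow> nat \<Rightarrow> nat \<Rightarrow> real \<Rightarrow> real \<Rightarrow> nat \<Rightarrow> nat \<Rightarrow> nat \<Rightarrow> real" where
  "blup N n K u v r i k = blup_weight N n K u v r i / real K"

definition group_totals :: "nat \<Rightarrow> nat \<Rightarrow> nat \<Rightarrow> (nat \<Rightarrow> nat \<Rightarrow> real) \<Rightarrow> real \<Rightarrow> real \<Rightarrow> bool" where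
  "group_totals N n K G a b \<longleftrightarrow> (\<Sum>i<n. \<Sum>k<K. G i k) = a \<and> (\<Sum>i=n..<N. \<Sum>k<K. G i k) = b"

lemma sum_split_groups:
  fixes f :: "nat \<Rightarrow> real"
  assumes "n \<le> N"
  shows "(\<Sum>i<N. f i) = (\<Sum>i<n. f i) + (\<Sum>i=n..<N. f i)"
  using assms by (simp add: lessThan_atLeast0 sum.atLeastLessThan_concat)

context two_group_rcr
begin

lemma n_le_N: "n \<le> N" using sizes by simp

lemma integrable_centred_product:
  assumes "e \<in> effects N K" "f \<in> effects N K"
  shows "integrable (P \<mu> \<alpha>) (\<lambda>\<omega>. (X e \<omega> - a) * (X f \<omega> - b))"
proof -
  interpret prob_space "P \<mu> \<alpha>" by (rule prob)
  have "integrable (P \<mu> \<alpha>) (\<lambda>\<omega>. X e \<omega> * X f \<omega>)"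
    using assms by (intro integrable_mult_of_squares L2 borel_measurable_integrable L1)
  moreover have "(\<lambda>\<omega>. (X e \<omega> - a) * (X f \<omega> - b)) =
      (\<lambda>\<omega>. X e \<omega> * X f \<omega> - b * X e \<omega> - a * X f \<omega> + a * b)"
    by (simp add: algebra_simps)
  ultimately show ?thesis using assms L1 by simp
qed

lemma mean_combination:
  "(LINT \<omega>|P \<mu> \<alpha>. (\<Sum>e\<in>effects N K. c e * X e \<omega>)) = (\<Sum>e\<in>effects N K. c e * effect_mean \<mu> \<alpha> e)"
  using L1 by (simp add: Bochner_Integration.integral_sum mean)

lemma covar_combination:
  "covar (P \<mu> \<alpha>) (\<lambda>\<omega>. \<Sum>e\<in>effects N K. c e * X e \<omega>) (\<lambda>\<omega>. \<Sum>e\<in>effects N K. d e * X e \<omega>) =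
    effect_cov N K \<sigma>2 u v c d"
proof -
  let ?E = "effects N K"
  let ?Y = "\<lambda>e \<omega>. X e \<omega> - effect_mean \<mu> \<alpha> e"
  have centre: "(\<Sum>e\<in>?E. c e * X e \<omega>) - (LINT \<omega>|P \<mu> \<alpha>. (\<Sum>e\<in>?E. c e * X e \<omega>)) =
      (\<Sum>e\<in>?E. c e * ?Y e \<omega>)" for c \<omega>
    by (simp add: mean_combination right_diff_distrib sum_subtractf)
  have pair: "(LINT \<omega>|P \<mu> \<alpha>. ?Y e \<omega> * ?Y f \<omega>) = (if f = e then effect_var \<sigma>2 u v e else 0)"
    if "e \<in> ?E" "f \<in> ?E" for e f
    using that var[of e \<mu> \<alpha>] uncorrelated[of e f \<mu> \<alpha>] by (auto simp: covar_def mean)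
  have int: "integrable (P \<mu> \<alpha>) (\<lambda>\<omega>. a * (?Y e \<omega> * ?Y f \<omega>))" if "e \<in> ?E" "f \<in> ?E" for a e f
    by (intro integrable_mult_right integrable_centred_product that)
  have "covar (P \<mu> \<alpha>) (\<lambda>\<omega>. \<Sum>e\<in>?E. c e * X e \<omega>) (\<lambda>\<omega>. \<Sum>e\<in>?E. d e * X e \<omega>) =
      (LINT \<omega>|P \<mu> \<alpha>. (\<Sum>e\<in>?E. \<Sum>f\<in>?E. c e * d f * (?Y e \<omega> * ?Y f \<omega>)))"
    unfolding covar_def centre by (simp add: sum_product mult_ac)
  also have "\<dots> = (\<Sum>e\<in>?E. \<Sum>f\<in>?E. c e * d f * (LINT \<omega>|P \<mu> \<alpha>. ?Y e \<omega> * ?Y f \<omega>))"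
  proof -
    have "(LINT \<omega>|P \<mu> \<alpha>. (\<Sum>e\<in>?E. \<Sum>f\<in>?E. c e * d f * (?Y e \<omega> * ?Y f \<omega>))) =
        (\<Sum>e\<in>?E. (LINT \<omega>|P \<mu> \<alpha>. (\<Sum>f\<in>?E. c e * d f * (?Y e \<omega> * ?Y f \<omega>))))"
      by (rule Bochner_Integration.integral_sum, rule Bochner_Integration.integrable_sum, rule int)
    also have "\<dots> = (\<Sum>e\<in>?E. \<Sum>f\<in>?E. (LINT \<omega>|P \<mu> \<alpha>. c e * d f * (?Y e \<omega> * ?Y f \<omega>)))"
      by (rule sum.cong[OF refl], rule Bochner_Integration.integral_sum, rule int)
    finally show ?thesis by simp
  qed
  also have "\<dots> = (\<Sum>e\<in>?E. \<Sum>f\<in>?E. if f = e then c e * d e * effect_var \<sigma>2 u v e else 0)"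
    by (intro sum.cong) (auto simp: pair)
  also have "\<dots> = effect_cov N K \<sigma>2 u v c d"
    by (simp add: effect_cov_def finite_effects mult_ac)
  finally show ?thesis .
qed

text \<open>
  The mean of the error is an affine function of the two unknown means. It vanishes identically
  exactly if the coefficient of \<open>\<mu>\<close>, the total of all weights, is \<open>0\<close>, and that of \<open>\<alpha>\<close>, the total over
  the treated individuals minus \<open>1\<close>, is \<open>0\<close> as well.
\<close>

lemma unbiased_iff_group_totals:
  "unbiased N n K P X C \<longleftrightarrow> (\<forall>r<N. group_totals N n K (C r) 1 (- 1))"
proof -
  have mean_error: "(LINT \<omega>|P \<mu> \<alpha>. pred_error N n K X C r \<omega>) =
      \<mu> * (\<Sum>i<N. \<Sum>k<K. C r i k) + \<alpha> * ((\<Sum>i<n. \<Sum>k<K. C r i k) - 1)"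
    if "r < N" for r \<mu> \<alpha>
  proof -
    have "(LINT \<omega>|P \<mu> \<alpha>. pred_error N n K X C r \<omega>) =
        (\<Sum>e\<in>effects N K. err_coeff n K C r e * effect_mean \<mu> \<alpha> e)"
      using that n_le_N by (simp only: pred_error_combination mean_combination)
    also have "\<dots> = \<mu> * (\<Sum>i<N. \<Sum>k<K. C r i k) +
        \<alpha> * (\<Sum>i<N. (if i < n then \<Sum>k<K. C r i k else 0) - (if i = r then 1 else 0))"
      by (simp add: sum_effects err_coeff_def sum_distrib_left mult_ac)
    finally show ?thesis using that n_le_N by (simp add: sum_subtractf sum_treated)
  qed
  have affine: "(\<forall>\<mu> \<alpha>. \<mu> * S + \<alpha> * (T - 1) = 0) \<longleftrightarrow> S = 0 \<and> T = 1" for S T :: real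
  proof
    assume *: "\<forall>\<mu> \<alpha>. \<mu> * S + \<alpha> * (T - 1) = 0"
    show "S = 0 \<and> T = 1" using *[rule_format, of 1 0] *[rule_format, of 0 1] by simp
  qed simp
  have quantifier_swap: "(\<forall>\<mu> \<alpha>. \<forall>r<N. Q r \<mu> \<alpha>) \<longleftrightarrow> (\<forall>r<N. \<forall>\<mu> \<alpha>. Q r \<mu> \<alpha>)"
    for Q :: "nat \<Rightarrow> real \<Rightarrow> real \<Rightarrow> bool" by blast
  have "unbiased N n K P X C \<longleftrightarrow>
      (\<forall>r<N. \<forall>\<mu> \<alpha>. (LINT \<omega>|P \<mu> \<alpha>. pred_error N n K X C r \<omega>) = 0)"
    unfolding unbiased_def by (rule quantifier_swap)
  also have "\<dots> \<longleftrightarrow> (\<forall>r<N. (\<Sum>i<N. \<Sum>k<K. C r i k) = 0 \<and> (\<Sum>i<n. \<Sum>k<K. C r i k) = 1)"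
    by (simp only: mean_error affine cong: conj_cong imp_cong)
  also have "\<dots> \<longleftrightarrow> (\<forall>r<N. group_totals N n K (C r) 1 (- 1))"
    unfolding group_totals_def sum_split_groups[OF n_le_N] by auto
  finally show ?thesis .
qed

lemma error_cov_carrier: "error_cov N n K X M C \<in> carrier_mat N N"
  by (simp add: error_cov_def)

lemma error_cov_index:
  assumes "r < N" "s < N"
  shows "error_cov N n K X (P \<mu> \<alpha>) C $$ (r, s) =
    effect_cov N K \<sigma>2 u v (err_coeff n K C r) (err_coeff n K C s)"
  using assms n_le_N by (simp add: error_cov_def pred_error_combination covar_combination)

lemma error_cov_quadratic_form:
  assumes "x \<in> carrier_vec N"
  shows "scalar_prod x (error_cov N n K X (P \<mu> \<alpha>) C *\<^sub>v x) =
    effect_cov N K \<sigma>2 u v (\<lambda>e. \<Sum>r<N. x $ r * err_coeff n K C r e) (\<lambda>e. \<Sum>r<N. x $ r * err_coeff n K C r e)"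
proof -
  let ?c = "err_coeff n K C"
  have x: "x = vec N (\<lambda>i. x $ i)" using assms by auto
  have "scalar_prod x (error_cov N n K X (P \<mu> \<alpha>) C *\<^sub>v x) =
      (\<Sum>r<N. \<Sum>s<N. x $ r * effect_cov N K \<sigma>2 u v (?c r) (?c s) * x $ s)"
    by (subst (1 2) x, subst quadratic_form_mat[OF error_cov_carrier])
      (intro sum.cong refl, simp add: error_cov_index)
  also have "\<dots> = (\<Sum>r<N. \<Sum>s<N. \<Sum>e\<in>effects N K.
      effect_var \<sigma>2 u v e * (x $ r * ?c r e) * (x $ s * ?c s e))"
    by (simp add: effect_cov_def sum_distrib_left sum_distrib_right mult_ac)
  also have "\<dots> = (\<Sum>e\<in>effects N K. \<Sum>r<N. \<Sum>s<N.
      effect_var \<sigma>2 u v e * (x $ r * ?c r e) * (x $ s * ?c s e))"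
    by (subst (2) sum.swap, subst sum.swap, rule refl)
  also have "\<dots> = effect_cov N K \<sigma>2 u v (\<lambda>e. \<Sum>r<N. x $ r * ?c r e) (\<lambda>e. \<Sum>r<N. x $ r * ?c r e)"
    by (simp add: effect_cov_def sum_distrib_left sum_distrib_right mult_ac)
  finally show ?thesis .
qed

text \<open>
  This identity carries the optimality of the predictor: its error has the same covariance with all
  observations of one group. Thus the error is uncorrelated with every linear combination of
  observations whose weights sum to zero within each group, that is, with every difference of two
  unbiased predictors. The shrinkage factor is chosen such that the observations of a treated \<open>r\<close>
  are no exception within their group. For group totals \<open>1\<close> and \<open>- 1\<close> the identity also yields the
  covariance of the error with any unbiased predictor.
\<close>

lemma effect_cov_blup_obs:
  assumes "r < N" and G: "group_totals N n K G a b"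
  shows "effect_cov N K \<sigma>2 u v (err_coeff n K (blup N n K u v) r) (obs_coeff n K G) =
    \<sigma>2 * ((if r < n then real K * u + 1 else real K * (u + v) + 1) / (real K * real n) * a
      - (real K * u + 1) / (real K * (real N - real n)) * b)"
proof -
  let ?c = "err_coeff n K (blup N n K u v) r"
  define x where "x = (if r < n then real K * u + 1 else real K * (u + v) + 1) / (real K * real n)"
  define y where "y = (real K * u + 1) / (real K * (real N - real n))"
  have Kp: "0 < real K" and np: "0 < real n" and mp: "real n < real N" using sizes by auto
  have Ap: "0 < real K * (u + v) + 1" using pos Kp by (simp add: add_pos_pos)
  have coeffs: "?c (Mu i) = blup_weight N n K u v r i"
    "?c (Eps i k) = blup_weight N n K u v r i / real K"
    "i < n \<Longrightarrow> ?c (Alpha i) = blup_weight N n K u v r i - (if i = r then 1 else 0)" for i k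
    using Kp by (auto simp: err_coeff_def blup_def)
  have treated: "u * ?c (Mu i) + v * ?c (Alpha i) + ?c (Eps i k) = x" if "i < n" for i k
    using that Kp np Ap by (auto simp: x_def coeffs blup_weight_def) (simp_all add: divide_simps, (simp_all add: algebra_simps)?)
  have control: "u * ?c (Mu i) + ?c (Eps i k) = - y" if "n \<le> i" for i k
    using that Kp mp by (simp add: y_def coeffs blup_weight_def divide_simps) (simp add: algebra_simps)?
  have "effect_cov N K \<sigma>2 u v ?c (obs_coeff n K G) =
      \<sigma>2 * ((\<Sum>i<n. \<Sum>k<K. G i k * x) + (\<Sum>i=n..<N. \<Sum>k<K. G i k * (- y)))"
    unfolding effect_cov_obs[OF n_le_N] sum_split_groups[OF n_le_N]
    by (simp add: treated control)
  also have "\<dots> = \<sigma>2 * (a * x + b * (- y))"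
    using G by (simp only: group_totals_def sum_distrib_right[symmetric])
  finally show ?thesis unfolding x_def[symmetric] y_def[symmetric] by (simp add: mult.commute)
qed

lemma group_totals_blup:
  assumes "r < N"
  shows "group_totals N n K (blup N n K u v r) 1 (- 1)"
proof -
  define c where "c = real K * v / (real K * (u + v) + 1)"
  have np: "0 < real n" and mp: "real n < real N" using sizes by auto
  have weight: "(\<Sum>k<K. blup N n K u v r i k) = blup_weight N n K u v r i" for i
    using sizes by (simp add: blup_def)
  have "(\<Sum>i<n. blup_weight N n K u v r i) =
      (\<Sum>i<n. 1 / real n) + (if r < n then c * (\<Sum>i<n. (if i = r then 1 else 0) - 1 / real n) else 0)"
    by (simp add: blup_weight_def c_def sum.distrib sum_distrib_left)
  also have "\<dots> = 1" using np by (simp add: sum_subtractf)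
  finally have treated: "(\<Sum>i<n. blup_weight N n K u v r i) = 1" .
  have "(\<Sum>i=n..<N. blup_weight N n K u v r i) = (\<Sum>i=n..<N. - 1 / (real N - real n))"
    by (intro sum.cong) (auto simp: blup_weight_def)
  also have "\<dots> = - 1" using mp n_le_N by (simp add: of_nat_diff)
  finally show ?thesis using treated by (simp add: group_totals_def weight)
qed

lemma effect_var_nonneg: "0 \<le> effect_var \<sigma>2 u v e"
  using pos by (cases e) auto

text \<open>
  Pythagoras: for every vector \<open>x\<close>, the combined error of another unbiased predictor is the sum of
  the combined error \<open>f\<close> of \<open>blup\<close> and of a combination of observations with vanishing group totals.
  By \<open>effect_cov_blup_obs\<close> these are orthogonal, hence the second one can only add variance.
\<close>

lemma is_blup_blup: "is_blup N n K P X (blup N n K u v)"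
  unfolding is_blup_def loewner_le_def
proof (intro conjI allI impI ballI)
  let ?B = "blup N n K u v"
  show "unbiased N n K P X ?B"
    unfolding unbiased_iff_group_totals using group_totals_blup by blast
  fix C \<mu> \<alpha> and x :: "real vec"
  assume C: "unbiased N n K P X C" and x: "x \<in> carrier_vec N"
  define f where "f e = (\<Sum>r<N. x $ r * err_coeff n K ?B r e)" for e
  define g where "g e = (\<Sum>r<N. x $ r * err_coeff n K C r e)" for e
  define G where "G i k = (\<Sum>r<N. x $ r * (C r i k - ?B r i k))" for i k
  have swap: "(\<Sum>i\<in>I. \<Sum>k<K. G i k) =
      (\<Sum>r<N. x $ r * ((\<Sum>i\<in>I. \<Sum>k<K. C r i k) - (\<Sum>i\<in>I. \<Sum>k<K. ?B r i k)))" for I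
    unfolding G_def sum_subtractf[symmetric] sum_distrib_left
    by (subst (2) sum.swap, subst sum.swap, rule refl)
  have G_zero_totals: "group_totals N n K G 0 0"
    using C group_totals_blup unfolding unbiased_iff_group_totals group_totals_def swap by auto
  have "(\<Sum>k<K. G i k) = (\<Sum>r<N. x $ r * ((\<Sum>k<K. C r i k) - (\<Sum>k<K. ?B r i k)))" for i
    unfolding G_def sum_subtractf[symmetric] sum_distrib_left by (rule sum.swap)
  then have g: "g e = f e + obs_coeff n K G e" for e
    unfolding f_def g_def
    by (cases e) (simp_all add: err_coeff_def G_def sum.distrib[symmetric] algebra_simps)
  have "effect_cov N K \<sigma>2 u v f (obs_coeff n K G) =
      (\<Sum>r<N. x $ r * effect_cov N K \<sigma>2 u v (err_coeff n K ?B r) (obs_coeff n K G))"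
    unfolding effect_cov_def f_def sum_distrib_left sum_distrib_right
    by (subst sum.swap) (simp add: mult_ac)
  also have "\<dots> = 0" using effect_cov_blup_obs[OF _ G_zero_totals] by simp
  finally have orth: "effect_cov N K \<sigma>2 u v f (obs_coeff n K G) = 0" .
  have "effect_cov N K \<sigma>2 u v g g = effect_cov N K \<sigma>2 u v f f +
      2 * effect_cov N K \<sigma>2 u v f (obs_coeff n K G) +
      effect_cov N K \<sigma>2 u v (obs_coeff n K G) (obs_coeff n K G)"
    by (simp add: g effect_cov_def sum_distrib_left sum.distrib[symmetric] algebra_simps)
  moreover have "0 \<le> effect_cov N K \<sigma>2 u v (obs_coeff n K G) (obs_coeff n K G)"
    unfolding effect_cov_def
    by (intro sum_nonneg) (simp add: mult.assoc effect_var_nonneg)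
  ultimately have "effect_cov N K \<sigma>2 u v f f \<le> effect_cov N K \<sigma>2 u v g g"
    using orth by simp
  then show "scalar_prod x (error_cov N n K X (P \<mu> \<alpha>) ?B *\<^sub>v x)
      \<le> scalar_prod x (error_cov N n K X (P \<mu> \<alpha>) C *\<^sub>v x)"
    unfolding error_cov_quadratic_form[OF x] f_def g_def .
qed

text \<open>
  Two best predictors are below each other in the Loewner order, so that their error covariances
  agree. The criterion therefore does not depend on the choice of a best predictor.
\<close>

lemma error_cov_is_blup:
  assumes C: "is_blup N n K P X C"
  shows "error_cov N n K X (P \<mu> \<alpha>) C = error_cov N n K X (P \<mu> \<alpha>) (blup N n K u v)"
proof (rule loewner_le_antisym[OF error_cov_carrier error_cov_carrier])
  show "loewner_le N (error_cov N n K X (P \<mu> \<alpha>) C) (error_cov N n K X (P \<mu> \<alpha>) (blup N n K u v))"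
    "loewner_le N (error_cov N n K X (P \<mu> \<alpha>) (blup N n K u v)) (error_cov N n K X (P \<mu> \<alpha>) C)"
    using C is_blup_blup unfolding is_blup_def by blast+
qed (simp_all add: error_cov_index effect_cov_commute)

section \<open>The exact criterion\<close>

lemma error_cov_blup_index:
  assumes "r < N" "s < N"
  shows "error_cov N n K X (P \<mu> \<alpha>) (blup N n K u v) $$ (r, s) =
    \<sigma>2 * ((if r < n then real K * u + 1 else real K * (u + v) + 1) / (real K * real n)
      + (real K * u + 1) / (real K * (real N - real n))
      - v * ((if s < n then blup_weight N n K u v r s else 0) - (if r = s then 1 else 0)))"
proof -
  have "err_coeff n K (blup N n K u v) r (Alpha s) =
      (if s < n then blup_weight N n K u v r s else 0) - (if r = s then 1 else 0)"
    using sizes by (auto simp: err_coeff_def blup_def)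
  moreover have "\<sigma>2 * (x * 1 - y * - 1) - v * \<sigma>2 * z = \<sigma>2 * (x + y - v * z)" for x y z
    by (simp add: algebra_simps)
  ultimately show ?thesis
    using assms by (simp only: error_cov_index effect_cov_err effect_cov_blup_obs[OF _ group_totals_blup])
qed

text \<open>
  The error covariance is constant on the two groups apart from the diagonal. Its treated diagonal
  block has the row sums \<open>n b\<close>, where \<open>b\<close> is both the covariance of errors in different groups and the
  variance of the average treated error. Hence eliminating the off-diagonal block subtracts exactly
  \<open>b\<close> from the control block and leaves \<open>\<sigma>2 v\<close> times the identity plus the constant \<open>\<sigma>2 v / n\<close>: the
  covariance of the differences between the average treated effect and the single control effects.
\<close>

lemma det_error_cov_blup:
  defines "w \<equiv> real n / real N"
  shows "Determinant.det (error_cov N n K X (P \<mu> \<alpha>) (blup N n K u v)) =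
    (\<sigma>2 ^ N * v ^ (N - 1) * (real K * (u + v) + 1) * (1 / real K)) *
      ((real K * u + 1) / (real K * (u + v) + 1)) ^ n / (w * (1 - w))"
proof -
  define m where "m = N - n"
  define A where "A = real K * (u + v) + 1"
  define B where "B = real K * u + 1"
  define p where "p = \<sigma>2 * v * (B / A)"
  define b where "b = \<sigma>2 * (B / (real K * real n) + B / (real K * real m))"
  have N: "N = n + m" and np: "0 < n" and mp: "0 < m" using sizes by (auto simp: m_def)
  have Kp: "0 < real K" using sizes by simp
  have Bp: "0 < B" using pos Kp by (simp add: B_def add_pos_pos)
  have AB: "A = B + real K * v" by (simp add: A_def B_def algebra_simps)
  have Ap: "0 < A" using Bp pos Kp by (simp add: AB add_pos_pos)
  have bp: "0 < b" using pos Bp Kp np mp by (simp add: b_def add_pos_pos)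
  \<comment> \<open>\<open>p\<close> is the residual variance in the linear regression of a treated effect on the average observation of its individual\<close>
  have "error_cov N n K X (P \<mu> \<alpha>) (blup N n K u v) = mat (n + m) (n + m) (\<lambda>(i, j).
      (if i = j then (if i < n then p else \<sigma>2 * v) else 0) +
      (if i < n \<and> j < n then b - p / real n else if i < n \<or> j < n then b
       else b + \<sigma>2 * v / real n))" (is "?E = ?M")
  proof (rule eq_matI)
    fix i j assume "i < dim_row ?M" "j < dim_col ?M"
    then have ij: "i < N" "j < N" by (auto simp: N)
    have "?E $$ (i, j) = \<sigma>2 * ((if i < n then B else A) / (real K * real n) + B / (real K * real m)
      - v * ((if j < n then blup_weight N n K u v i j else 0) - (if i = j then 1 else 0)))"
      unfolding error_cov_blup_index[OF ij] using n_le_N by (simp add: A_def B_def m_def of_nat_diff)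
    also have "\<dots> = ?M $$ (i, j)"
      using ij np mp Kp Ap unfolding N
      by (auto simp: blup_weight_def A_def[symmetric] b_def p_def; simp add: divide_simps; simp add: AB algebra_simps)
    finally show "?E $$ (i, j) = ?M $$ (i, j)" .
  qed (auto simp: error_cov_def N)
  then have "Determinant.det ?E = p ^ (n - 1) * (\<sigma>2 * v) ^ (m - 1) *
      ((p + real n * (b - p / real n)) * (\<sigma>2 * v + real m * (b + \<sigma>2 * v / real n)) - real n * real m * b\<^sup>2)"
    using det_two_group_constant[OF np mp, of p "b - p / real n" "\<sigma>2 * v" b "b + \<sigma>2 * v / real n"] np bp
    by (simp add: right_diff_distrib)
  also have "\<dots> = p ^ (n - 1) * (\<sigma>2 * v) ^ (m - 1) * (b * (\<sigma>2 * v) * real N)"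
    using np by (simp add: N field_simps power2_eq_square)
  also have "\<dots> = (\<sigma>2 ^ N * v ^ (N - 1) * A * (1 / real K)) * (B / A) ^ n / (w * (1 - w))"
  proof -
    obtain n' m' where n': "n = Suc n'" and m': "m = Suc m'"
      using np mp by (metis gr0_implies_Suc)
    have b: "b = \<sigma>2 * B * real N / (real K * (real n * real m))"
      using np mp Kp by (simp add: b_def N field_simps)
    have w: "w * (1 - w) = real n * real m / (real N * real N)"
      using np mp by (simp add: w_def N field_simps)
    have nz: "real n \<noteq> 0" "real m \<noteq> 0" "real N \<noteq> 0" using np mp by (auto simp: N)
    have "p ^ (n - 1) * (\<sigma>2 * v) ^ (m - 1) * (\<sigma>2 * v) = (\<sigma>2 * v) ^ (N - 1) * (B / A) ^ (n - 1)"
      unfolding p_def by (simp add: n' m' N power_mult_distrib power_add power_divide)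
    then have "p ^ (n - 1) * (\<sigma>2 * v) ^ (m - 1) * (b * (\<sigma>2 * v) * real N) =
        (\<sigma>2 * v) ^ (N - 1) * (B / A) ^ (n - 1) * (b * real N)"
      by (metis mult.assoc mult.commute)
    also have "b * real N = \<sigma>2 * A * (1 / real K) * (B / A) / (w * (1 - w))"
      using nz Ap Kp unfolding b w by (simp add: divide_simps)
    also have "(\<sigma>2 * v) ^ (N - 1) * (B / A) ^ (n - 1) * (\<sigma>2 * A * (1 / real K) * (B / A) / (w * (1 - w))) =
        (\<sigma>2 ^ N * v ^ (N - 1) * A * (1 / real K)) * (B / A) ^ n / (w * (1 - w))"
      by (simp add: n' N power_mult_distrib)
    finally show ?thesis .
  qed
  finally show ?thesis by (simp add: A_def B_def)
qed

lemma D_exact_is_blup: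
  assumes "is_blup N n K P X C"
  shows "D_exact N n K X (P \<mu> \<alpha>) C = D_approx N K \<sigma>2 u v (real n / real N)"
proof -
  define w where "w = real n / real N"
  define d where "d = \<sigma>2 ^ N * v ^ (N - 1) * (real K * (u + v) + 1) * (1 / real K)"
  define \<rho> where "\<rho> = (real K * u + 1) / (real K * (u + v) + 1)"
  have Kp: "0 < real K" using sizes by simp
  have A: "0 < real K * (u + v) + 1" "0 < real K * u + 1" using pos Kp by (simp_all add: add_pos_pos)
  have d: "0 < d" and \<rho>: "0 < \<rho>" and w: "0 < w * (1 - w)" and nw: "real n = real N * w"
    using pos Kp A sizes by (simp_all add: d_def \<rho>_def w_def)
  have "D_exact N n K X (P \<mu> \<alpha>) C = ln (d * \<rho> ^ n / (w * (1 - w)))"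
    unfolding D_exact_def error_cov_is_blup[OF assms] det_error_cov_blup d_def \<rho>_def w_def ..
  also have "\<dots> = ln d + real n * ln \<rho> - ln (w * (1 - w))"
  proof -
    have "ln (d * \<rho> ^ n / x) = ln d + real n * ln \<rho> - ln x" if "0 < x" for x
      using d \<rho> that by (simp add: ln_div ln_mult ln_realpow)
    then show ?thesis using w .
  qed
  also have "\<dots> = D_approx N K \<sigma>2 u v w"
    by (simp only: D_approx_def d_def \<rho>_def nw)
  finally show ?thesis by (simp add: w_def)
qed

end

section \<open>Minimization of the approximate criterion\<close>

text \<open>
  The condition \<open>s = 1 / w - 1 / (1 - w)\<close> says that the derivative of \<open>s w - ln (w (1 - w))\<close> vanishes. It is
  the quadratic equation \<open>w\<^sup>2 - (1 + 2 / s) w + 1 / s = 0\<close>, and for negative \<open>s\<close> the root with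
  the positive sign is the one in the unit interval.
\<close>

lemma linear_minus_ln_stationary:
  fixes s w :: real
  assumes "s < 0" and w: "w = 1 / s + 1 / 2 + sqrt (1 / s\<^sup>2 + 1 / 4)"
  shows "0 < w" "w < 1" "s = 1 / w - 1 / (1 - w)"
proof -
  define a where "a = 1 / s"
  define q where "q = sqrt (a\<^sup>2 + 1 / 4)"
  have a: "a < 0" and wq: "w = a + 1 / 2 + q"
    using assms by (auto simp: a_def q_def power_one_over)
  have q2: "q\<^sup>2 = a\<^sup>2 + 1 / 4" unfolding q_def by (rule real_sqrt_pow2) (simp add: add_nonneg_nonneg)
  have "sqrt (a\<^sup>2) < q" unfolding q_def by (rule real_sqrt_less_mono) simp
  then have lower: "- a < q" using a by simp
  have "q < sqrt ((1 / 2 - a)\<^sup>2)" unfolding q_def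
    by (rule real_sqrt_less_mono) (use a in \<open>simp add: power2_eq_square algebra_simps\<close>)
  then have upper: "q < 1 / 2 - a" using a by simp
  show w01: "0 < w" "w < 1" using lower upper wq by auto
  have "(w - a - 1 / 2)\<^sup>2 = a\<^sup>2 + 1 / 4" using q2 wq by simp
  then have "a * (1 - 2 * w) = w * (1 - w)" by (simp add: power2_eq_square algebra_simps)
  then have "1 - 2 * w = s * (w * (1 - w))"
    using \<open>s < 0\<close> by (simp add: a_def field_simps)
  then show "s = 1 / w - 1 / (1 - w)"
    using w01 by (simp add: field_simps)
qed

text \<open>
  Instead of convexity, the tangent inequality \<open>ln x \<le> x - 1\<close>, strict for \<open>x \<noteq> 1\<close>, is applied to \<open>y / w\<close> and
  \<open>(1 - y) / (1 - w)\<close>; at a stationary \<open>w\<close> the two linear bounds add up to \<open>s (y - w)\<close>.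
\<close>

lemma linear_minus_ln_strict_minimum:
  fixes s w y d :: real
  assumes "0 < w" "w < 1" "0 < y" "y < 1" "y \<noteq> w" and s: "s = 1 / w - 1 / (1 - w)"
  shows "d + s * w - ln (w * (1 - w)) < d + s * y - ln (y * (1 - y))"
proof -
  have "ln (y / w) \<le> y / w - 1" "ln (y / w) \<noteq> y / w - 1"
    using assms ln_le_minus_one[of "y / w"] ln_eq_minus_one[of "y / w"] by auto
  moreover have "ln ((1 - y) / (1 - w)) \<le> (1 - y) / (1 - w) - 1"
    using assms by (intro ln_le_minus_one) auto
  moreover have "s * (y - w) = (y / w - 1) + ((1 - y) / (1 - w) - 1)"
    using assms unfolding s by (simp add: field_simps)
  ultimately have "ln (y / w) + ln ((1 - y) / (1 - w)) < s * (y - w)" by linarith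
  moreover have "ln (y / w) = ln y - ln w" "ln ((1 - y) / (1 - w)) = ln (1 - y) - ln (1 - w)"
    "ln (w * (1 - w)) = ln w + ln (1 - w)" "ln (y * (1 - y)) = ln y + ln (1 - y)"
    using assms by (simp_all add: ln_div ln_mult)
  ultimately show ?thesis unfolding right_diff_distrib by linarith
qed

lemma is_arg_min_D_approx:
  fixes N K :: nat and \<sigma>2 u v t :: real
  assumes "0 < N" "0 < K" "0 < u" "0 < v"
    and t: "t = ln ((real K * u + 1) / (real K * (u + v) + 1))"
  shows "is_arg_min (D_approx N K \<sigma>2 u v) (\<lambda>w. 0 < w \<and> w < 1) w \<longleftrightarrow>
    w = 1 / (real N * t) + 1 / 2 + sqrt (1 / ((real N)\<^sup>2 * t\<^sup>2) + 1 / 4)"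
proof -
  define s where "s = real N * t"
  define z where "z = 1 / s + 1 / 2 + sqrt (1 / s\<^sup>2 + 1 / 4)"
  define d where "d = ln (\<sigma>2 ^ N * v ^ (N - 1) * (real K * (u + v) + 1) * (1 / real K))"
  have "0 < real K * u + 1" "real K * u + 1 < real K * (u + v) + 1"
    using assms by (simp_all add: add_pos_pos)
  then have "t < 0" unfolding t by (intro ln_less_zero) (simp_all add: divide_simps)
  then have "s < 0" using assms by (simp add: s_def mult_pos_neg)
  note z = linear_minus_ln_stationary[OF this z_def]
  have D: "D_approx N K \<sigma>2 u v y = d + s * y - ln (y * (1 - y))" for y
    by (simp add: D_approx_def d_def s_def t mult_ac)
  have less: "D_approx N K \<sigma>2 u v z < D_approx N K \<sigma>2 u v y" if "0 < y" "y < 1" "y \<noteq> z" for y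
    unfolding D using that z by (intro linear_minus_ln_strict_minimum) auto
  then have "is_arg_min (D_approx N K \<sigma>2 u v) (\<lambda>w. 0 < w \<and> w < 1) w \<longleftrightarrow> w = z"
    using z unfolding is_arg_min_def by (metis less_asym)
  then show ?thesis by (simp add: z_def s_def power_mult_distrib)
qed

theorem theorem13:
  fixes N K :: nat and \<sigma>2 u v t :: real
  assumes "2 \<le> N" and "1 \<le> K" and "0 < \<sigma>2" and "0 < u" and "0 < v"
    and t: "t = ln ((real K * u + 1) / (real K * (u + v) + 1))"
  shows "(\<forall>n (P :: real \<Rightarrow> real \<Rightarrow> 'w measure) X. two_group_rcr N n K \<sigma>2 u v P X \<longrightarrow>
           (\<exists>C. is_blup N n K P X C) \<and>
           (\<forall>C \<mu> \<alpha>. is_blup N n K P X C \<longrightarrow>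
             D_exact N n K X (P \<mu> \<alpha>) C = D_approx N K \<sigma>2 u v (real n / real N))) \<and>
         (\<forall>w. is_arg_min (D_approx N K \<sigma>2 u v) (\<lambda>w. 0 < w \<and> w < 1) w \<longleftrightarrow>
           w = 1 / (real N * t) + 1 / 2 + sqrt (1 / ((real N)\<^sup>2 * t\<^sup>2) + 1 / 4))"
proof (intro conjI allI impI)
  fix n and P :: "real \<Rightarrow> real \<Rightarrow> 'w measure" and X
  assume model: "two_group_rcr N n K \<sigma>2 u v P X"
  show "\<exists>C. is_blup N n K P X C"
    using two_group_rcr.is_blup_blup[OF model] by blast
  show "D_exact N n K X (P \<mu> \<alpha>) C = D_approx N K \<sigma>2 u v (real n / real N)"
    if "is_blup N n K P X C" for C \<mu> \<alpha>
    using two_group_rcr.D_exact_is_blup[OF model that] .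
next
  fix w
  show "is_arg_min (D_approx N K \<sigma>2 u v) (\<lambda>w. 0 < w \<and> w < 1) w \<longleftrightarrow>
      w = 1 / (real N * t) + 1 / 2 + sqrt (1 / ((real N)\<^sup>2 * t\<^sup>2) + 1 / 4)"
    using assms by (intro is_arg_min_D_approx) auto
qed

end
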